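(* Let $K(\widehat\sigma_\varepsilon,\widehat\nu)$ be the confidence interval for $b$ constructed after the Hausman pretest, with the estimators $\widehat\sigma_\varepsilon,\widehat\nu$ defined in the context. Then the conditional coverage probability $P(b\in K(\widehat\sigma_\varepsilon,\widehat\nu)\mid x)$ is determined by $x$, $\alpha_H$, $1-\alpha$, $\nu=\sigma_\eta^2/\sigma_\varepsilon^2$ and $\gamma=\xi N^{1/2}/\sigma_\varepsilon$. Given these quantities, the conditional coverage probability does not depend on $\sigma_\varepsilon^2$ or $\sigma_\eta^2$. (That is, for fixed $x,\alpha_H,\alpha$, the probability is a function of the parameters $(a,b,\xi,\sigma_\varepsilon,\sigma_\eta)$ only through $(\gamma,\nu)$.)
   Context: Model. Let $N\ge 3$, $T\ge 2$, and let $x=(x_{11},\dots,x_{1T},\dots,x_{N1},\dots,x_{NT})$ be given real numbers; all probabilities are conditional on $x$, i.e. $x$ is treated as fixed. For $i=1,\dots,N$, $t=1,\dots,T$, $$y_{it}=a+b\,x_{it}+\xi\,\overline{x}_i+\eta_i+\varepsilon_{it},\qquad \overline{x}_i=T^{-1}\sum_{t=1}^T x_{it},$$ where $a,b,\xi\in\mathbb{R}$ are unknown, the $\eta_i$ and $\varepsilon_{it}$ are all independent, $\eta_i\sim N(0,\sigma_\eta^2)$, $\varepsilon_{it}\sim N(0,\sigma_\varepsilon^2)$, $\sigma_\eta,\sigma_\varepsilon>0$. Put $\nu=\sigma_\eta^2/\sigma_\varepsilon^2\in(0,\infty)$ and $\gamma=\xi N^{1/2}/\sigma_\varepsilon$.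 Overbars with index $i$ denote averages over $t$ (e.g. $\overline{y}_i$), and overbars without index denote averages of these over $i$ (e.g. $\overline{x}=N^{-1}\sum_i\overline{x}_i$). Let $SSB=\sum_{i}(\overline{x}_i-\overline{x})^2$, $SSW=\sum_{i}\sum_{t}(x_{it}-\overline{x}_i)^2$, both assumed positive, $r(x)=SSB/SSW$, and $q(n,T)=n+T^{-1}$. Estimators of slopes. $\widetilde b_W=\sum_i\sum_t(x_{it}-\overline{x}_i)(y_{it}-\overline{y}_i)/SSW$ and $\widetilde b_B=\sum_i(\overline{x}_i-\overline{x})(\overline{y}_i-\overline{y})/SSB$, with $\mathrm{Var}(\widetilde b_W\mid x)=\sigma_\varepsilon^2/SSW$ and $\mathrm{Var}(\widetilde b_B\mid x)=\sigma_\varepsilon^2 q(\nu,T)/SSB$. The estimator $\widehat b$ is the GLS estimator of $b$ in the model with $\xi=0$; explicitly $\widehat b=w\widetilde b_W+(1-w)\widetilde b_B$ with $w=q(\nu,T)/(q(\nu,T)+r(x))$, and $\mathrm{Var}(\widehat b\mid x)=\sigma_\varepsilon^2 w/SSW$. Estimators of variances. With $r_{it}=(y_{it}-\overline{y}_i)-\widetilde b_W(x_{it}-\overline{x}_i)$, $\widehat\sigma_\varepsilon^2=\frac{1}{N(T-1)}\sum_i\sum_t r_{it}^2$. With $\widetilde a=\overline{y}-\widetilde b_B\overline{x}$ and $\widetilde r_i=\overline{y}_i-(\widetilde a+\widetilde b_B\overline{x}_i)$, $\widehat\sigma_\eta^2=N^{-1}\sum_i\widetilde r_i^2-T^{-1}\widehat\sigma_\varepsilon^2$.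 Finally $\widehat\nu=\widehat\sigma_\eta^2/\widehat\sigma_\varepsilon^2$. Two-stage interval. Let $\alpha,\alpha_H\in(0,1)$ and $z_c=\Phi^{-1}(c)$, $\Phi$ the $N(0,1)$ cdf. Define $I(\sigma_\varepsilon,\nu)=[\widehat b\pm z_{1-\alpha/2}\mathrm{Var}(\widehat b\mid x)^{1/2}]$, $J(\sigma_\varepsilon)=[\widetilde b_W\pm z_{1-\alpha/2}\mathrm{Var}(\widetilde b_W\mid x)^{1/2}]$ and the Hausman statistic $H(\sigma_\varepsilon,\nu)=(\widetilde b_W-\widetilde b_B)^2/(\mathrm{Var}(\widetilde b_W\mid x)+\mathrm{Var}(\widetilde b_B\mid x))$. $K(\sigma_\varepsilon,\nu)$ equals $I(\sigma_\varepsilon,\nu)$ if $H(\sigma_\varepsilon,\nu)\le z_{1-\alpha_H/2}^2$ and equals $J(\sigma_\varepsilon)$ otherwise. $I(\widehat\sigma_\varepsilon,\widehat\nu)$, $J(\widehat\sigma_\varepsilon)$, $H(\widehat\sigma_\varepsilon,\widehat\nu)$, $K(\widehat\sigma_\varepsilon,\widehat\nu)$ are obtained by replacing $\sigma_\varepsilon,\nu$ everywhere in these definitions (including in the weight $w$ in $\widehat b$ and in the variance formulas) by $\widehat\sigma_\varepsilon,\widehat\nu$. Here $1-\alpha$ is the nominal coverage of $K$ and $\alpha_H$ the nominal level of the pretest. *)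

theory Defs
  imports "HOL-Probability.Probability"
begin

(* Panel data z i t are read only for i in {1..N}, t in {1..T}. *)

definition tmean :: "nat \<Rightarrow> (nat \<Rightarrow> nat \<Rightarrow> real) \<Rightarrow> nat \<Rightarrow> real" where
  "tmean T z i = (\<Sum>t=1..T. z i t) / real T"

definition gmean :: "nat \<Rightarrow> nat \<Rightarrow> (nat \<Rightarrow> nat \<Rightarrow> real) \<Rightarrow> real" where
  "gmean N T z = (\<Sum>i=1..N. tmean T z i) / real N"

definition SSB :: "nat \<Rightarrow> nat \<Rightarrow> (nat \<Rightarrow> nat \<Rightarrow> real) \<Rightarrow> real" where
  "SSB N T x = (\<Sum>i=1..N. (tmean T x i - gmean N T x)\<^sup>2)"

definition SSW :: "nat \<Rightarrow> nat \<Rightarrow> (nat \<Rightarrow> nat \<Rightarrow> real) \<Rightarrow> real" where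
  "SSW N T x = (\<Sum>i=1..N. \<Sum>t=1..T. (x i t - tmean T x i)\<^sup>2)"

locale panel_model = prob_space M
  for M :: "'w measure" +
  fixes N T :: nat
    and x :: "nat \<Rightarrow> nat \<Rightarrow> real"
    and a b \<xi> \<sigma>\<^sub>\<eta> \<sigma>\<^sub>\<epsilon> :: real
    and \<eta> :: "nat \<Rightarrow> 'w \<Rightarrow> real"
    and \<epsilon> :: "nat \<Rightarrow> nat \<Rightarrow> 'w \<Rightarrow> real"
    and y :: "nat \<Rightarrow> nat \<Rightarrow> 'w \<Rightarrow> real"
  assumes sigma_eta_pos: "\<sigma>\<^sub>\<eta> > 0"
    and sigma_eps_pos: "\<sigma>\<^sub>\<epsilon> > 0"
    and eta_normal: "\<And>i. i \<in> {1..N} \<Longrightarrow> distributed M lborel (\<eta> i) (normal_density 0 \<sigma>\<^sub>\<eta>)"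
    and eps_normal: "\<And>i t. i \<in> {1..N} \<Longrightarrow> t \<in> {1..T} \<Longrightarrow>
           distributed M lborel (\<epsilon> i t) (normal_density 0 \<sigma>\<^sub>\<epsilon>)"
    (* the disjoint sum index makes all eta i and eps i t jointly independent *)
    and all_indep: "indep_vars (\<lambda>_. borel) (case_sum \<eta> (\<lambda>(i, t). \<epsilon> i t))
           ({1..N} <+> ({1..N} \<times> {1..T}))"
    and response: "\<And>i t \<omega>. i \<in> {1..N} \<Longrightarrow> t \<in> {1..T} \<Longrightarrow> \<omega> \<in> space M \<Longrightarrow>
           y i t \<omega> = a + b * x i t + \<xi> * tmean T x i + \<eta> i \<omega> + \<epsilon> i t \<omega>"

definition r_ratio :: "nat \<Rightarrow> nat \<Rightarrow> (nat \<Rightarrow> nat \<Rightarrow> real) \<Rightarrow> real" where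
  "r_ratio N T x = SSB N T x / SSW N T x"

definition q :: "real \<Rightarrow> nat \<Rightarrow> real" where
  "q n T = n + 1 / real T"

definition b_within :: "nat \<Rightarrow> nat \<Rightarrow> (nat \<Rightarrow> nat \<Rightarrow> real) \<Rightarrow> (nat \<Rightarrow> nat \<Rightarrow> real) \<Rightarrow> real" where
  "b_within N T x y =
     (\<Sum>i=1..N. \<Sum>t=1..T. (x i t - tmean T x i) * (y i t - tmean T y i)) / SSW N T x"

definition b_between :: "nat \<Rightarrow> nat \<Rightarrow> (nat \<Rightarrow> nat \<Rightarrow> real) \<Rightarrow> (nat \<Rightarrow> nat \<Rightarrow> real) \<Rightarrow> real" where
  "b_between N T x y =
     (\<Sum>i=1..N. (tmean T x i - gmean N T x) * (tmean T y i - gmean N T y)) / SSB N T x"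

definition gls_weight :: "nat \<Rightarrow> nat \<Rightarrow> (nat \<Rightarrow> nat \<Rightarrow> real) \<Rightarrow> real \<Rightarrow> real" where
  "gls_weight N T x \<nu> = q \<nu> T / (q \<nu> T + r_ratio N T x)"

definition b_gls :: "nat \<Rightarrow> nat \<Rightarrow> (nat \<Rightarrow> nat \<Rightarrow> real) \<Rightarrow> (nat \<Rightarrow> nat \<Rightarrow> real) \<Rightarrow> real \<Rightarrow> real" where
  "b_gls N T x y \<nu> =
     gls_weight N T x \<nu> * b_within N T x y + (1 - gls_weight N T x \<nu>) * b_between N T x y"

(* Conditional variances of the slope estimators, as functions of (sigma_eps, nu), so that
   estimates can be plugged in. *)

definition var_within :: "nat \<Rightarrow> nat \<Rightarrow> (nat \<Rightarrow> nat \<Rightarrow> real) \<Rightarrow> real \<Rightarrow> real" where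
  "var_within N T x \<sigma> = \<sigma>\<^sup>2 / SSW N T x"

definition var_between :: "nat \<Rightarrow> nat \<Rightarrow> (nat \<Rightarrow> nat \<Rightarrow> real) \<Rightarrow> real \<Rightarrow> real \<Rightarrow> real" where
  "var_between N T x \<sigma> \<nu> = \<sigma>\<^sup>2 * q \<nu> T / SSB N T x"

definition var_gls :: "nat \<Rightarrow> nat \<Rightarrow> (nat \<Rightarrow> nat \<Rightarrow> real) \<Rightarrow> real \<Rightarrow> real \<Rightarrow> real" where
  "var_gls N T x \<sigma> \<nu> = \<sigma>\<^sup>2 * gls_weight N T x \<nu> / SSW N T x"

definition within_residual ::
  "nat \<Rightarrow> nat \<Rightarrow> (nat \<Rightarrow> nat \<Rightarrow> real) \<Rightarrow> (nat \<Rightarrow> nat \<Rightarrow> real) \<Rightarrow> nat \<Rightarrow> nat \<Rightarrow> real" where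
  "within_residual N T x y i t =
     (y i t - tmean T y i) - b_within N T x y * (x i t - tmean T x i)"

definition sigma_eps2_hat ::
  "nat \<Rightarrow> nat \<Rightarrow> (nat \<Rightarrow> nat \<Rightarrow> real) \<Rightarrow> (nat \<Rightarrow> nat \<Rightarrow> real) \<Rightarrow> real" where
  "sigma_eps2_hat N T x y =
     (\<Sum>i=1..N. \<Sum>t=1..T. (within_residual N T x y i t)\<^sup>2) / (real N * (real T - 1))"

definition a_between :: "nat \<Rightarrow> nat \<Rightarrow> (nat \<Rightarrow> nat \<Rightarrow> real) \<Rightarrow> (nat \<Rightarrow> nat \<Rightarrow> real) \<Rightarrow> real" where
  "a_between N T x y = gmean N T y - b_between N T x y * gmean N T x"

definition between_residual ::
  "nat \<Rightarrow> nat \<Rightarrow> (nat \<Rightarrow> nat \<Rightarrow> real) \<Rightarrow> (nat \<Rightarrow> nat \<Rightarrow> real) \<Rightarrow> nat \<Rightarrow> real" where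
  "between_residual N T x y i =
     tmean T y i - (a_between N T x y + b_between N T x y * tmean T x i)"

definition sigma_eta2_hat ::
  "nat \<Rightarrow> nat \<Rightarrow> (nat \<Rightarrow> nat \<Rightarrow> real) \<Rightarrow> (nat \<Rightarrow> nat \<Rightarrow> real) \<Rightarrow> real" where
  "sigma_eta2_hat N T x y =
     (\<Sum>i=1..N. (between_residual N T x y i)\<^sup>2) / real N - sigma_eps2_hat N T x y / real T"

definition sigma_eps_hat ::
  "nat \<Rightarrow> nat \<Rightarrow> (nat \<Rightarrow> nat \<Rightarrow> real) \<Rightarrow> (nat \<Rightarrow> nat \<Rightarrow> real) \<Rightarrow> real" where
  "sigma_eps_hat N T x y = sqrt (sigma_eps2_hat N T x y)"

(* sigma_eta2_hat and nu_hat may be negative, but q (nu_hat N T x y) T is always nonnegative.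
   The event sigma_eps2_hat = 0, where x / 0 = 0 applies, has probability zero in the model. *)
definition nu_hat :: "nat \<Rightarrow> nat \<Rightarrow> (nat \<Rightarrow> nat \<Rightarrow> real) \<Rightarrow> (nat \<Rightarrow> nat \<Rightarrow> real) \<Rightarrow> real" where
  "nu_hat N T x y = sigma_eta2_hat N T x y / sigma_eps2_hat N T x y"

(* The standard normal cdf is injective, so inv is its genuine inverse on (0,1). *)
definition z_quantile :: "real \<Rightarrow> real" where
  "z_quantile c = inv (cdf std_normal_distribution) c"

definition ci_centered :: "real \<Rightarrow> real \<Rightarrow> real set" where
  "ci_centered m h = {m - h .. m + h}"

definition I_ci :: "nat \<Rightarrow> nat \<Rightarrow> (nat \<Rightarrow> nat \<Rightarrow> real) \<Rightarrow> (nat \<Rightarrow> nat \<Rightarrow> real) \<Rightarrow>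
    real \<Rightarrow> real \<Rightarrow> real \<Rightarrow> real set" where
  "I_ci N T x y \<alpha> \<sigma> \<nu> =
     ci_centered (b_gls N T x y \<nu>) (z_quantile (1 - \<alpha> / 2) * sqrt (var_gls N T x \<sigma> \<nu>))"

definition J_ci :: "nat \<Rightarrow> nat \<Rightarrow> (nat \<Rightarrow> nat \<Rightarrow> real) \<Rightarrow> (nat \<Rightarrow> nat \<Rightarrow> real) \<Rightarrow>
    real \<Rightarrow> real \<Rightarrow> real set" where
  "J_ci N T x y \<alpha> \<sigma> =
     ci_centered (b_within N T x y) (z_quantile (1 - \<alpha> / 2) * sqrt (var_within N T x \<sigma>))"

definition hausman :: "nat \<Rightarrow> nat \<Rightarrow> (nat \<Rightarrow> nat \<Rightarrow> real) \<Rightarrow> (nat \<Rightarrow> nat \<Rightarrow> real) \<Rightarrow>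
    real \<Rightarrow> real \<Rightarrow> real" where
  "hausman N T x y \<sigma> \<nu> =
     (b_within N T x y - b_between N T x y)\<^sup>2 / (var_within N T x \<sigma> + var_between N T x \<sigma> \<nu>)"

definition K_ci :: "nat \<Rightarrow> nat \<Rightarrow> (nat \<Rightarrow> nat \<Rightarrow> real) \<Rightarrow> (nat \<Rightarrow> nat \<Rightarrow> real) \<Rightarrow>
    real \<Rightarrow> real \<Rightarrow> real \<Rightarrow> real \<Rightarrow> real set" where
  "K_ci N T x y \<alpha> \<alpha>\<^sub>H \<sigma> \<nu> =
     (if hausman N T x y \<sigma> \<nu> \<le> (z_quantile (1 - \<alpha>\<^sub>H / 2))\<^sup>2
      then I_ci N T x y \<alpha> \<sigma> \<nu> else J_ci N T x y \<alpha> \<sigma>)"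

definition K_hat :: "nat \<Rightarrow> nat \<Rightarrow> (nat \<Rightarrow> nat \<Rightarrow> real) \<Rightarrow> (nat \<Rightarrow> nat \<Rightarrow> real) \<Rightarrow>
    real \<Rightarrow> real \<Rightarrow> real set" where
  "K_hat N T x y \<alpha> \<alpha>\<^sub>H = K_ci N T x y \<alpha> \<alpha>\<^sub>H (sigma_eps_hat N T x y) (nu_hat N T x y)"

definition coverage :: "'w measure \<Rightarrow> nat \<Rightarrow> nat \<Rightarrow> (nat \<Rightarrow> nat \<Rightarrow> real) \<Rightarrow>
    (nat \<Rightarrow> nat \<Rightarrow> 'w \<Rightarrow> real) \<Rightarrow> real \<Rightarrow> real \<Rightarrow> real \<Rightarrow> real" where
  "coverage M N T x y b \<alpha> \<alpha>\<^sub>H =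
     measure M {\<omega> \<in> space M. b \<in> K_hat N T x (\<lambda>i t. y i t \<omega>) \<alpha> \<alpha>\<^sub>H}"

end

theory Submission
  imports Defs
begin

text \<open>On the range of the panel, \<open>y = a + b x + s u\<close> with \<open>s = sigma_eps\<close> and
  \<open>u = (xi / s) xbar + eta / s + eps / s\<close>. The two slope estimators and the standard error
  estimate are equivariant under \<open>u \<mapsto> a + b x + s u\<close> for \<open>s > 0\<close>, while the estimate of
  \<open>\<nu>\<close> and the Hausman statistic are invariant. Hence \<open>b\<close> is covered for the data \<open>y\<close> iff
  \<open>0\<close> is covered for the data \<open>u\<close>. The law of \<open>u\<close> involves only \<open>\<gamma>\<close> and \<open>\<nu>\<close>, because
  \<open>eta / s\<close> and \<open>eps / s\<close> are independent centred normals with variances \<open>\<nu>\<close> and \<open>1\<close>.\<close>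

section \<open>Equivariance of the estimators\<close>

text \<open>The affine relation is required only on the index range, because the model equation says
  nothing about the response outside it and the estimators read nothing else.\<close>

context
  fixes N T :: nat and x y u :: "nat \<Rightarrow> nat \<Rightarrow> real" and a b s :: real
  assumes N_pos: "N > 0" and T_pos: "T > 0"
    and SSB_pos: "SSB N T x > 0" and SSW_pos: "SSW N T x > 0" and s_pos: "s > 0"
    and affine: "\<And>i t. i \<in> {1..N} \<Longrightarrow> t \<in> {1..T} \<Longrightarrow> y i t = a + b * x i t + s * u i t"
begin

lemma tmean_affine:
  assumes "i \<in> {1..N}"
  shows "tmean T y i = a + b * tmean T x i + s * tmean T u i"
proof -
  have "(\<Sum>t=1..T. y i t) = (\<Sum>t=1..T. a + b * x i t + s * u i t)"
    using assms affine by (intro sum.cong) auto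
  also have "\<dots> = real T * a + b * (\<Sum>t=1..T. x i t) + s * (\<Sum>t=1..T. u i t)"
    by (simp add: sum.distrib sum_distrib_left)
  finally show ?thesis
    using T_pos by (simp add: tmean_def field_simps)
qed

lemma gmean_affine: "gmean N T y = a + b * gmean N T x + s * gmean N T u"
proof -
  have "(\<Sum>i=1..N. tmean T y i) = (\<Sum>i=1..N. a + b * tmean T x i + s * tmean T u i)"
    using tmean_affine by (intro sum.cong) auto
  also have "\<dots> = real N * a + b * (\<Sum>i=1..N. tmean T x i) + s * (\<Sum>i=1..N. tmean T u i)"
    by (simp add: sum.distrib sum_distrib_left)
  finally show ?thesis
    using N_pos by (simp add: gmean_def field_simps)
qed

text \<open>Centring over \<open>t\<close> removes \<open>a\<close>, and the slope of centred
  \<open>x\<close> on itself is 1 since \<open>SSW\<close> is nonzero, so \<open>b\<close> passes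
  through unchanged. The between slope behaves in the same way with \<open>SSB\<close>.\<close>

lemma b_within_affine: "b_within N T x y = b + s * b_within N T x u"
proof -
  have "(\<Sum>i=1..N. \<Sum>t=1..T. (x i t - tmean T x i) * (y i t - tmean T y i)) =
      (\<Sum>i=1..N. \<Sum>t=1..T. b * (x i t - tmean T x i)\<^sup>2 +
        s * ((x i t - tmean T x i) * (u i t - tmean T u i)))"
    by (intro sum.cong refl)
      (simp add: affine tmean_affine power2_eq_square algebra_simps)
  also have "\<dots> = b * SSW N T x +
      s * (\<Sum>i=1..N. \<Sum>t=1..T. (x i t - tmean T x i) * (u i t - tmean T u i))"
    by (simp add: sum.distrib sum_distrib_left SSW_def)
  finally show ?thesis
    using SSW_pos by (simp add: b_within_def field_simps)
qed

lemma b_between_affine: "b_between N T x y = b + s * b_between N T x u"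
proof -
  have "(\<Sum>i=1..N. (tmean T x i - gmean N T x) * (tmean T y i - gmean N T y)) =
      (\<Sum>i=1..N. b * (tmean T x i - gmean N T x)\<^sup>2 +
        s * ((tmean T x i - gmean N T x) * (tmean T u i - gmean N T u)))"
    by (intro sum.cong refl)
      (simp add: tmean_affine gmean_affine power2_eq_square algebra_simps)
  also have "\<dots> = b * SSB N T x +
      s * (\<Sum>i=1..N. (tmean T x i - gmean N T x) * (tmean T u i - gmean N T u))"
    by (simp add: sum.distrib sum_distrib_left SSB_def)
  finally show ?thesis
    using SSB_pos by (simp add: b_between_def field_simps)
qed

lemma b_gls_affine: "b_gls N T x y \<nu> = b + s * b_gls N T x u \<nu>"
  by (simp add: b_gls_def b_within_affine b_between_affine algebra_simps)

text \<open>The shift \<open>b\<close> of the estimated slope cancels the term \<open>b * x\<close>,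
  so each residual of \<open>y\<close> is \<open>s\<close> times that of \<open>u\<close>.\<close>

lemma sigma_eps2_hat_affine: "sigma_eps2_hat N T x y = s\<^sup>2 * sigma_eps2_hat N T x u"
proof -
  have "(\<Sum>i=1..N. \<Sum>t=1..T. (within_residual N T x y i t)\<^sup>2) =
      (\<Sum>i=1..N. \<Sum>t=1..T. s\<^sup>2 * (within_residual N T x u i t)\<^sup>2)"
    unfolding power_mult_distrib[symmetric]
    by (intro sum.cong refl arg_cong[where f = "\<lambda>r. r\<^sup>2"])
      (simp add: within_residual_def affine tmean_affine b_within_affine algebra_simps)
  then show ?thesis
    by (simp add: sigma_eps2_hat_def sum_distrib_left)
qed

lemma sigma_eps_hat_affine: "sigma_eps_hat N T x y = s * sigma_eps_hat N T x u"
  using s_pos by (simp add: sigma_eps_hat_def sigma_eps2_hat_affine real_sqrt_mult)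

lemma sigma_eta2_hat_affine: "sigma_eta2_hat N T x y = s\<^sup>2 * sigma_eta2_hat N T x u"
proof -
  have "(\<Sum>i=1..N. (between_residual N T x y i)\<^sup>2) =
      (\<Sum>i=1..N. s\<^sup>2 * (between_residual N T x u i)\<^sup>2)"
    unfolding power_mult_distrib[symmetric]
    by (intro sum.cong refl arg_cong[where f = "\<lambda>r. r\<^sup>2"])
      (simp add: between_residual_def a_between_def tmean_affine gmean_affine b_between_affine
        algebra_simps)
  then show ?thesis
    by (simp add: sigma_eta2_hat_def sigma_eps2_hat_affine sum_distrib_left right_diff_distrib)
qed

text \<open>The factor \<open>s\<^sup>2\<close> cancels; if the denominator vanishes, both quotients
  are 0 by convention.\<close>

lemma nu_hat_affine: "nu_hat N T x y = nu_hat N T x u"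
  using s_pos by (simp add: nu_hat_def sigma_eps2_hat_affine sigma_eta2_hat_affine)

text \<open>Numerator and denominator are homogeneous of degree 2 in \<open>s\<close>. The scale
  \<sigma> is left arbitrary so that the estimate can be plugged in through
  \<open>sigma_eps_hat_affine\<close>.\<close>

lemma hausman_affine: "hausman N T x y (s * \<sigma>) \<nu> = hausman N T x u \<sigma> \<nu>"
proof -
  have "b_within N T x y - b_between N T x y = s * (b_within N T x u - b_between N T x u)"
    by (simp add: b_within_affine b_between_affine right_diff_distrib)
  moreover have "var_within N T x (s * \<sigma>) + var_between N T x (s * \<sigma>) \<nu> =
      s\<^sup>2 * (var_within N T x \<sigma> + var_between N T x \<sigma> \<nu>)"
    by (simp add: var_within_def var_between_def power_mult_distrib distrib_left mult.assoc)
  ultimately show ?thesis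
    using s_pos by (simp add: hausman_def power_mult_distrib)
qed

lemma ci_centered_affine: "b \<in> ci_centered (b + s * m) (s * h) \<longleftrightarrow> 0 \<in> ci_centered m h"
proof -
  have "s * m \<le> s * h \<longleftrightarrow> m \<le> h" "0 \<le> s * m + s * h \<longleftrightarrow> 0 \<le> m + h"
    using s_pos by (simp_all add: zero_le_mult_iff flip: distrib_left)
  then show ?thesis
    by (auto simp: ci_centered_def)
qed

lemma I_ci_affine: "b \<in> I_ci N T x y \<alpha> (s * \<sigma>) \<nu> \<longleftrightarrow> 0 \<in> I_ci N T x u \<alpha> \<sigma> \<nu>"
proof -
  \<comment> \<open>\<open>sqrt\<close> is an odd function and multiplicative on all reals, which
    covers a negative weight at an arbitrary \<nu>.\<close>
  have "sqrt (var_gls N T x (s * \<sigma>) \<nu>) = s * sqrt (var_gls N T x \<sigma> \<nu>)"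
    using s_pos by (simp add: var_gls_def power_mult_distrib real_sqrt_mult real_sqrt_divide)
  then show ?thesis
    using ci_centered_affine[of "b_gls N T x u \<nu>"]
    by (simp add: I_ci_def b_gls_affine mult.left_commute)
qed

lemma J_ci_affine: "b \<in> J_ci N T x y \<alpha> (s * \<sigma>) \<longleftrightarrow> 0 \<in> J_ci N T x u \<alpha> \<sigma>"
proof -
  have "sqrt (var_within N T x (s * \<sigma>)) = s * sqrt (var_within N T x \<sigma>)"
    using s_pos by (simp add: var_within_def power_mult_distrib real_sqrt_mult real_sqrt_divide)
  then show ?thesis
    using ci_centered_affine[of "b_within N T x u"]
    by (simp add: J_ci_def b_within_affine mult.left_commute)
qed

text \<open>The pretest takes the same branch for both data sets, and within each branch the
  coverage events agree.\<close>

lemma K_hat_affine: "b \<in> K_hat N T x y \<alpha> \<alpha>\<^sub>H \<longleftrightarrow> 0 \<in> K_hat N T x u \<alpha> \<alpha>\<^sub>H"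
  by (simp add: K_hat_def K_ci_def sigma_eps_hat_affine nu_hat_affine hausman_affine
      I_ci_affine J_ci_affine)

end

section \<open>The law of the standardised panel\<close>

definition panel_index :: "nat \<Rightarrow> nat \<Rightarrow> (nat + nat \<times> nat) set" where
  "panel_index N T = {1..N} <+> ({1..N} \<times> {1..T})"

definition std_panel ::
  "nat \<Rightarrow> (nat \<Rightarrow> nat \<Rightarrow> real) \<Rightarrow> real \<Rightarrow> (nat + nat \<times> nat \<Rightarrow> real) \<Rightarrow> nat \<Rightarrow> nat \<Rightarrow> real" where
  "std_panel T x c v i t = c * tmean T x i + v (Inl i) + v (Inr (i, t))"

text \<open>A reference law independent of any model space. Here \<tau> is a standard deviation: it
  stands for the square root of the variance ratio, not for the ratio itself.\<close>

definition noise_law :: "nat \<Rightarrow> nat \<Rightarrow> real \<Rightarrow> (nat + nat \<times> nat \<Rightarrow> real) measure" where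
  "noise_law N T \<tau> = PiM (panel_index N T)
     (\<lambda>k. density lborel (normal_density 0 (case k of Inl _ \<Rightarrow> \<tau> | Inr _ \<Rightarrow> 1)))"

lemma sets_noise_law [measurable_cong]:
  "sets (noise_law N T \<tau>) = sets (PiM (panel_index N T) (\<lambda>_. borel))"
  unfolding noise_law_def by (intro sets_PiM_cong) auto

lemma measurable_std_panel [measurable]:
  assumes "i \<in> {1..N}" "t \<in> {1..T}"
  shows "(\<lambda>v. std_panel T x c v i t) \<in> borel_measurable (PiM (panel_index N T) (\<lambda>_. borel))"
proof -
  have [measurable]: "Inl i \<in> panel_index N T" "Inr (i, t) \<in> panel_index N T"
    using assms by (auto simp: panel_index_def)
  show ?thesis
    unfolding std_panel_def by measurable
qed

text \<open>Coverage probabilities can be moved to the reference law by \<open>measure_distr\<close>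
  only for measurable events.\<close>

lemma measurable_covers:
  assumes [measurable]:
    "\<And>i t. i \<in> {1..N} \<Longrightarrow> t \<in> {1..T} \<Longrightarrow> (\<lambda>v. U v i t) \<in> borel_measurable P"
  shows "Measurable.pred P (\<lambda>v. b \<in> K_hat N T x (U v) \<alpha> \<alpha>\<^sub>H)"
proof -
  have [measurable]: "(\<lambda>v. tmean T (U v) i) \<in> borel_measurable P" if "i \<in> {1..N}" for i
    unfolding tmean_def using that by measurable
  have [measurable]: "(\<lambda>v. gmean N T (U v)) \<in> borel_measurable P"
    unfolding gmean_def by measurable
  have [measurable]: "(\<lambda>v. b_within N T x (U v)) \<in> borel_measurable P"
    unfolding b_within_def by measurable
  have [measurable]: "(\<lambda>v. b_between N T x (U v)) \<in> borel_measurable P"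
    unfolding b_between_def by measurable
  have [measurable]: "(\<lambda>v. sigma_eps2_hat N T x (U v)) \<in> borel_measurable P"
    unfolding sigma_eps2_hat_def within_residual_def by measurable
  have [measurable]: "(\<lambda>v. sigma_eta2_hat N T x (U v)) \<in> borel_measurable P"
    unfolding sigma_eta2_hat_def between_residual_def a_between_def by measurable
  have [measurable]: "(\<lambda>v. nu_hat N T x (U v)) \<in> borel_measurable P"
    unfolding nu_hat_def by measurable
  have [measurable]: "(\<lambda>v. sigma_eps_hat N T x (U v)) \<in> borel_measurable P"
    unfolding sigma_eps_hat_def by measurable
  let ?\<sigma> = "\<lambda>v. sigma_eps_hat N T x (U v)" and ?\<nu> = "\<lambda>v. nu_hat N T x (U v)"
  have [measurable]: "(\<lambda>v. var_within N T x (?\<sigma> v)) \<in> borel_measurable P"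
    unfolding var_within_def by measurable
  have [measurable]: "(\<lambda>v. var_between N T x (?\<sigma> v) (?\<nu> v)) \<in> borel_measurable P"
    unfolding var_between_def q_def by measurable
  have [measurable]: "(\<lambda>v. gls_weight N T x (?\<nu> v)) \<in> borel_measurable P"
    unfolding gls_weight_def q_def by measurable
  have [measurable]: "(\<lambda>v. hausman N T x (U v) (?\<sigma> v) (?\<nu> v)) \<in> borel_measurable P"
    unfolding hausman_def by measurable
  have [measurable]: "(\<lambda>v. var_gls N T x (?\<sigma> v) (?\<nu> v)) \<in> borel_measurable P"
    unfolding var_gls_def by measurable
  have [measurable]: "(\<lambda>v. b_gls N T x (U v) (?\<nu> v)) \<in> borel_measurable P"
    unfolding b_gls_def by measurable
  have [measurable]: "Measurable.pred P (\<lambda>v. b \<in> I_ci N T x (U v) \<alpha> (?\<sigma> v) (?\<nu> v))"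
    unfolding I_ci_def ci_centered_def atLeastAtMost_iff by measurable
  have [measurable]: "Measurable.pred P (\<lambda>v. b \<in> J_ci N T x (U v) \<alpha> (?\<sigma> v))"
    unfolding J_ci_def ci_centered_def atLeastAtMost_iff by measurable
  \<comment> \<open>Membership is pushed through the \<open>if\<close>, which turns the event into a
    case split between measurable predicates.\<close>
  have "b \<in> K_hat N T x (U v) \<alpha> \<alpha>\<^sub>H \<longleftrightarrow>
      (if hausman N T x (U v) (?\<sigma> v) (?\<nu> v) \<le> (z_quantile (1 - \<alpha>\<^sub>H / 2))\<^sup>2
       then b \<in> I_ci N T x (U v) \<alpha> (?\<sigma> v) (?\<nu> v) else b \<in> J_ci N T x (U v) \<alpha> (?\<sigma> v))" for v
    by (simp add: K_hat_def K_ci_def)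
  then show ?thesis
    by simp
qed

section \<open>Joint law of the standardised noise in a panel model\<close>

context panel_model
begin

definition std_noise :: "nat + nat \<times> nat \<Rightarrow> 'w \<Rightarrow> real" where
  "std_noise k \<omega> = case_sum \<eta> (\<lambda>(i, t). \<epsilon> i t) k \<omega> / \<sigma>\<^sub>\<epsilon>"

lemma distributed_std_noise:
  assumes "k \<in> panel_index N T"
  shows "distributed M lborel (std_noise k)
    (normal_density 0 (case k of Inl _ \<Rightarrow> \<sigma>\<^sub>\<eta> / \<sigma>\<^sub>\<epsilon> | Inr _ \<Rightarrow> 1))"
proof -
  have scale: "distributed M lborel (\<lambda>\<omega>. X \<omega> / \<sigma>\<^sub>\<epsilon>) (normal_density 0 (\<sigma> / \<sigma>\<^sub>\<epsilon>))"
    if "distributed M lborel X (normal_density 0 \<sigma>)" "\<sigma> > 0" for X \<sigma>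
    using normal_density_affine[OF that, of "1 / \<sigma>\<^sub>\<epsilon>" 0] sigma_eps_pos by simp
  show ?thesis
    using assms eta_normal eps_normal scale sigma_eta_pos sigma_eps_pos
    by (fastforce simp: panel_index_def std_noise_def[abs_def])
qed

lemma std_noise_measurable:
  assumes "k \<in> panel_index N T"
  shows "std_noise k \<in> borel_measurable M"
  using distributed_measurable[OF distributed_std_noise[OF assms]] by simp

text \<open>Rescaling each coordinate preserves independence, and independence makes the joint law
  the product of the marginals.\<close>

lemma distr_std_noise:
  assumes "N > 0"
  shows "distr M (PiM (panel_index N T) (\<lambda>_. borel)) (\<lambda>\<omega>. \<lambda>k\<in>panel_index N T. std_noise k \<omega>) =
    noise_law N T (\<sigma>\<^sub>\<eta> / \<sigma>\<^sub>\<epsilon>)"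
proof -
  have "indep_vars (\<lambda>_. borel) std_noise (panel_index N T)"
    unfolding std_noise_def[abs_def] panel_index_def
    by (rule indep_vars_compose2[OF all_indep]) simp
  \<comment> \<open>The product characterisation of independence is stated for a nonempty index
    set.\<close>
  moreover have "panel_index N T \<noteq> {}"
    using assms by (auto simp: panel_index_def)
  ultimately have "distr M (PiM (panel_index N T) (\<lambda>_. borel))
      (\<lambda>\<omega>. \<lambda>k\<in>panel_index N T. std_noise k \<omega>) =
    PiM (panel_index N T) (\<lambda>k. distr M borel (std_noise k))"
    using indep_vars_iff_distr_eq_PiM'[of "panel_index N T" std_noise "\<lambda>_. borel"]
      std_noise_measurable by blast
  also have "\<dots> = noise_law N T (\<sigma>\<^sub>\<eta> / \<sigma>\<^sub>\<epsilon>)"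
    unfolding noise_law_def
  proof (rule PiM_cong[OF refl])
    fix k assume "k \<in> panel_index N T"
    note D = distributed_std_noise[OF this]
    \<comment> \<open>The densities are given relative to \<open>lborel\<close>, whose sigma-algebra
      is that of \<open>borel\<close>.\<close>
    have "distr M borel (std_noise k) = distr M lborel (std_noise k)"
      by (rule distr_cong) auto
    with distributed_distr_eq_density[OF D]
    show "distr M borel (std_noise k) =
        density lborel (normal_density 0 (case k of Inl _ \<Rightarrow> \<sigma>\<^sub>\<eta> / \<sigma>\<^sub>\<epsilon> | Inr _ \<Rightarrow> 1))"
      by simp
  qed
  finally show ?thesis .
qed

text \<open>The right-hand side mentions neither \<open>M\<close> nor \<open>a\<close> nor
  \<open>b\<close>, and the other parameters only through two ratios.\<close>

lemma coverage_eq_noise_law: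
  assumes "N > 0" "T > 0" "SSB N T x > 0" "SSW N T x > 0"
  shows "coverage M N T x y b \<alpha> \<alpha>\<^sub>H = measure (noise_law N T (\<sigma>\<^sub>\<eta> / \<sigma>\<^sub>\<epsilon>))
    {v \<in> space (noise_law N T (\<sigma>\<^sub>\<eta> / \<sigma>\<^sub>\<epsilon>)). 0 \<in> K_hat N T x (std_panel T x (\<xi> / \<sigma>\<^sub>\<epsilon>) v) \<alpha> \<alpha>\<^sub>H}"
proof -
  let ?P = "PiM (panel_index N T) (\<lambda>_. borel :: real measure)"
  \<comment> \<open>Restriction to the index set makes \<open>V\<close> land in the product space,
    whose points are extensional functions; \<open>std_panel\<close> evaluates it only at indices of
    the panel.\<close>
  define V where "V \<omega> = (\<lambda>k\<in>panel_index N T. std_noise k \<omega>)" for \<omega>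
  define C where "C = {v \<in> space ?P. 0 \<in> K_hat N T x (std_panel T x (\<xi> / \<sigma>\<^sub>\<epsilon>) v) \<alpha> \<alpha>\<^sub>H}"
  have V: "V \<in> measurable M ?P"
    unfolding V_def[abs_def] using std_noise_measurable by (intro measurable_restrict)
  have C: "C \<in> sets ?P"
    unfolding C_def using measurable_covers[OF measurable_std_panel] by (simp add: pred_def)
  have "b \<in> K_hat N T x (\<lambda>i t. y i t \<omega>) \<alpha> \<alpha>\<^sub>H \<longleftrightarrow>
      0 \<in> K_hat N T x (std_panel T x (\<xi> / \<sigma>\<^sub>\<epsilon>) (V \<omega>)) \<alpha> \<alpha>\<^sub>H" if "\<omega> \<in> space M" for \<omega>
  proof (rule K_hat_affine[where a = a and s = \<sigma>\<^sub>\<epsilon>])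
    fix i t assume it: "i \<in> {1..N}" "t \<in> {1..T}"
    then have "Inl i \<in> panel_index N T" "Inr (i, t) \<in> panel_index N T"
      by (auto simp: panel_index_def)
    then show "y i t \<omega> = a + b * x i t + \<sigma>\<^sub>\<epsilon> * std_panel T x (\<xi> / \<sigma>\<^sub>\<epsilon>) (V \<omega>) i t"
      using response[OF it that] sigma_eps_pos
      by (simp add: std_panel_def V_def std_noise_def distrib_left)
  qed (use assms sigma_eps_pos in auto)
  then have "coverage M N T x y b \<alpha> \<alpha>\<^sub>H = measure M (V -` C \<inter> space M)"
    unfolding coverage_def C_def using measurable_space[OF V]
    by (intro arg_cong[where f = "measure M"]) auto
  also have "\<dots> = measure (distr M ?P V) C"
    using measure_distr[OF V C] by simp
  also have "distr M ?P V = noise_law N T (\<sigma>\<^sub>\<eta> / \<sigma>\<^sub>\<epsilon>)"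
    using distr_std_noise[OF assms(1)] by (simp add: V_def[abs_def])
  finally show ?thesis
    by (simp add: C_def sets_eq_imp_space_eq[OF sets_noise_law])
qed

end

theorem theorem1:
  fixes N T :: nat
    and x :: "nat \<Rightarrow> nat \<Rightarrow> real"
    and \<alpha> \<alpha>\<^sub>H :: real
    and M :: "'w measure" and M' :: "'v measure"
    and a b \<xi> \<sigma>\<^sub>\<eta> \<sigma>\<^sub>\<epsilon> a' b' \<xi>' \<sigma>\<^sub>\<eta>' \<sigma>\<^sub>\<epsilon>' :: real
  assumes "N \<ge> 3" and "T \<ge> 2"
    and "SSB N T x > 0" and "SSW N T x > 0"
    and "0 < \<alpha>" and "\<alpha> < 1" and "0 < \<alpha>\<^sub>H" and "\<alpha>\<^sub>H < 1"
    and "panel_model M N T x a b \<xi> \<sigma>\<^sub>\<eta> \<sigma>\<^sub>\<epsilon> \<eta> \<epsilon> y"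
    and "panel_model M' N T x a' b' \<xi>' \<sigma>\<^sub>\<eta>' \<sigma>\<^sub>\<epsilon>' \<eta>' \<epsilon>' y'"
    and same_nu: "\<sigma>\<^sub>\<eta>\<^sup>2 / \<sigma>\<^sub>\<epsilon>\<^sup>2 = \<sigma>\<^sub>\<eta>'\<^sup>2 / \<sigma>\<^sub>\<epsilon>'\<^sup>2"
    and same_gamma: "\<xi> * sqrt (real N) / \<sigma>\<^sub>\<epsilon> = \<xi>' * sqrt (real N) / \<sigma>\<^sub>\<epsilon>'"
  shows "coverage M N T x y b \<alpha> \<alpha>\<^sub>H = coverage M' N T x y' b' \<alpha> \<alpha>\<^sub>H"
proof -
  note pos = panel_model.sigma_eta_pos[OF assms(9)] panel_model.sigma_eps_pos[OF assms(9)]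
    panel_model.sigma_eta_pos[OF assms(10)] panel_model.sigma_eps_pos[OF assms(10)]
  \<comment> \<open>The reference law is parametrised by standard deviations while the hypothesis
    compares variances; positivity allows taking roots.\<close>
  have "(\<sigma>\<^sub>\<eta> / \<sigma>\<^sub>\<epsilon>)\<^sup>2 = (\<sigma>\<^sub>\<eta>' / \<sigma>\<^sub>\<epsilon>')\<^sup>2"
    unfolding power_divide by (rule same_nu)
  then have nu: "\<sigma>\<^sub>\<eta> / \<sigma>\<^sub>\<epsilon> = \<sigma>\<^sub>\<eta>' / \<sigma>\<^sub>\<epsilon>'"
    by (rule power2_eq_imp_eq) (use pos in simp_all)
  have "sqrt (real N) * (\<xi> / \<sigma>\<^sub>\<epsilon>) = sqrt (real N) * (\<xi>' / \<sigma>\<^sub>\<epsilon>')"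
    using same_gamma by (simp only: times_divide_eq_right mult.commute)
  then have gamma: "\<xi> / \<sigma>\<^sub>\<epsilon> = \<xi>' / \<sigma>\<^sub>\<epsilon>'"
    by (rule mult_left_cancel[THEN iffD1, rotated]) (use \<open>N \<ge> 3\<close> in simp)
  have "N > 0" "T > 0"
    using \<open>N \<ge> 3\<close> \<open>T \<ge> 2\<close> by simp_all
  note * = this \<open>SSB N T x > 0\<close> \<open>SSW N T x > 0\<close>
  show ?thesis
    unfolding panel_model.coverage_eq_noise_law[OF assms(9) *]
      panel_model.coverage_eq_noise_law[OF assms(10) *] nu gamma ..
qed

end
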